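(* Suppose $\phi=\psi_1$ is the ReLU, $\psi_1(x)=\max(x,0)$. Then in a full residual network (FRN), with mean-field quantities $p^{(l)},\gamma^{(l)},e^{(l)},s^{(l)}$, we have $e^{(l)}\to1$ and $$1-e^{(l)}\sim\Big[\tfrac14\,\sigma_v^2\sigma_w^2\,B^{-1}U\,l\Big]^{-2}\quad\text{for } B=1+\sigma_v^2\sigma_w^2/2\ \text{ and }\ U=\frac{2\sqrt2}{3\pi}.$$ As a result, $s^{(l)}=(1-e^{(l)})p^{(l)}=\Theta\big(l^{-2}\exp(\Theta(l))\big)=\exp(\Theta(l))$.
   Context: Put $\mathrm V\phi(q)=\mathbb E[\phi(z)^2]$ for $z\sim\mathcal N(0,q)$, and $\mathrm W\phi(\rho,\nu)=\mathbb E[\phi(z)\phi(z')]$ for $(z,z')\sim\mathcal N\!\left(0,\begin{pmatrix}\rho&\nu\\ \nu&\rho\end{pmatrix}\right)$. An FRN of width $N$ has layers $x^{(l)}_i=\sum_jv^{(l)}_{ij}\phi(h^{(l)}_j)+x^{(l-1)}_i+a^{(l)}_i$, $h^{(l)}_i=\sum_jw^{(l)}_{ij}x^{(l-1)}_j+b^{(l)}_i$ with independent Gaussian parameters of mean $0$ and variances $\sigma_v^2/N$, $\sigma_a^2$, $\sigma_w^2/N$, $\sigma_b^2$ respectively for $v,a,w,b$. Take two inputs $x^{(0)},x^{(0)\prime}$ with the same normalized squared length $p^{(0)}=\|x^{(0)}\|^2/N=\|x^{(0)\prime}\|^2/N$, and let $\gamma^{(0)}=x^{(0)}\cdot x^{(0)\prime}/N$.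 The mean-field ($N\to\infty$) quantities $p^{(l)}=\langle (x^{(l)}_1)^2\rangle$, $q^{(l)}=\langle (h^{(l)}_1)^2\rangle$, $\gamma^{(l)}=\langle x^{(l)}_1x^{(l)\prime}_1\rangle$, $\lambda^{(l)}=\langle h^{(l)}_1h^{(l)\prime}_1\rangle$ satisfy, for $l\ge1$, $$q^{(l)}=\sigma_w^2p^{(l-1)}+\sigma_b^2,\quad p^{(l)}=\sigma_v^2\,\mathrm V\phi(q^{(l)})+\sigma_a^2+p^{(l-1)},$$ $$\lambda^{(l)}=\sigma_w^2\gamma^{(l-1)}+\sigma_b^2,\quad \gamma^{(l)}=\sigma_v^2\,\mathrm W\phi(q^{(l)},\lambda^{(l)})+\sigma_a^2+\gamma^{(l-1)}.$$ Further $e^{(l)}=\gamma^{(l)}/p^{(l)}$ and $s^{(l)}=p^{(l)}-\gamma^{(l)}$. Asymptotics are as $l\to\infty$, and $f\sim g$ means $f/g\to1$. *)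

theory Defs
  imports "HOL-Probability.Probability" "HOL-Library.Landau_Symbols"
begin

text \<open>
  Centred Gaussian laws are given as images of standard ones, so that degenerate variances and
  covariance matrices need no separate treatment. The symmetric matrix with diagonal \<open>\<rho>\<close> and
  off-diagonal \<open>\<nu>\<close>, where \<open>\<bar>\<nu>\<bar> \<le> \<rho>\<close>, has eigenvectors \<open>(1,1)\<close> and \<open>(1,-1)\<close> with
  eigenvalues \<open>\<rho> + \<nu>\<close> and \<open>\<rho> - \<nu>\<close>; this yields the linear map below.
\<close>

definition gauss1 :: "real \<Rightarrow> real measure" where
  "gauss1 q = distr std_normal_distribution borel (\<lambda>\<xi>. sqrt q * \<xi>)"

definition gauss2 :: "real \<Rightarrow> real \<Rightarrow> (real \<times> real) measure" where
  "gauss2 \<rho> \<nu> =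
     distr (std_normal_distribution \<Otimes>\<^sub>M std_normal_distribution) (borel \<Otimes>\<^sub>M borel)
       (\<lambda>(\<xi>, \<eta>). (sqrt ((\<rho> + \<nu>) / 2) * \<xi> + sqrt ((\<rho> - \<nu>) / 2) * \<eta>,
                   sqrt ((\<rho> + \<nu>) / 2) * \<xi> - sqrt ((\<rho> - \<nu>) / 2) * \<eta>))"

lemma char_gauss1:
  assumes "q \<ge> 0"
  shows "char (gauss1 q) t = exp (- (q * t\<^sup>2) / 2)"
proof -
  have "char (gauss1 q) t = char std_normal_distribution (sqrt q * t)"
    unfolding char_def gauss1_def
    by (subst integral_distr) (auto simp: mult_ac)
  thus ?thesis
    using assms by (simp add: char_std_normal_distribution power_mult_distrib)
qed

lemma char_gauss2:
  assumes "\<bar>\<nu>\<bar> \<le> \<rho>"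
  shows "(LINT (z, z')|gauss2 \<rho> \<nu>. iexp (s * z + t * z')) =
           exp (- (\<rho> * s\<^sup>2 + 2 * \<nu> * s * t + \<rho> * t\<^sup>2) / 2)"
proof -
  let ?N = "std_normal_distribution"
  define a where "a = sqrt ((\<rho> + \<nu>) / 2)"
  define b where "b = sqrt ((\<rho> - \<nu>) / 2)"
  have ab: "a\<^sup>2 = (\<rho> + \<nu>) / 2" "b\<^sup>2 = (\<rho> - \<nu>) / 2"
    using assms by (auto simp: a_def b_def)
  interpret N: real_distribution ?N by (rule real_dist_normal_dist)
  interpret NN: pair_sigma_finite ?N ?N ..
  interpret NNp: pair_prob_space ?N ?N ..
  have "(LINT (z, z')|gauss2 \<rho> \<nu>. iexp (s * z + t * z')) =
        (LINT p|(?N \<Otimes>\<^sub>M ?N). iexp ((s + t) * a * fst p + (s - t) * b * snd p))"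
    unfolding gauss2_def a_def b_def
    by (subst integral_distr)
       (auto simp: case_prod_beta algebra_simps cong: Bochner_Integration.integral_cong)
  also have "\<dots> = (LINT \<xi>|?N. LINT \<eta>|?N. iexp ((s + t) * a * \<xi> + (s - t) * b * \<eta>))"
    by (subst NN.integral_fst'[symmetric])
       (auto intro!: NNp.integrable_const_bound[where B = 1])
  also have "\<dots> = char ?N ((s + t) * a) * char ?N ((s - t) * b)"
    by (simp add: char_def exp_add distrib_left)
  also have "\<dots> = exp (- (((s + t) * a)\<^sup>2 + ((s - t) * b)\<^sup>2) / 2)"
    by (simp add: char_std_normal_distribution exp_of_real[symmetric] exp_add[symmetric]
          add_divide_distrib diff_divide_distrib)
  also have "((s + t) * a)\<^sup>2 + ((s - t) * b)\<^sup>2 = \<rho> * s\<^sup>2 + 2 * \<nu> * s * t + \<rho> * t\<^sup>2"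
    unfolding power_mult_distrib ab by (simp add: power2_eq_square field_simps)
  finally show ?thesis .
qed

definition V :: "(real \<Rightarrow> real) \<Rightarrow> real \<Rightarrow> real" where
  "V \<phi> q = (LINT z|gauss1 q. (\<phi> z)\<^sup>2)"

definition W :: "(real \<Rightarrow> real) \<Rightarrow> real \<Rightarrow> real \<Rightarrow> real" where
  "W \<phi> \<rho> \<nu> = (LINT (z, z')|gauss2 \<rho> \<nu>. \<phi> z * \<phi> z')"

definition relu :: "real \<Rightarrow> real" where
  "relu x = max x 0"

text \<open>
  The mean-field (infinite width) quantities of a full residual network with activation \<open>\<phi>\<close> and
  parameter standard deviations \<open>\<sigma>v, \<sigma>a, \<sigma>w, \<sigma>b\<close>, for a pair of inputs of equal length. Being
  moments of the preactivations of layers \<open>l \<ge> 1\<close>, \<open>q\<close> and \<open>\<Lambda>\<close> are not constrained at \<open>0\<close>.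
\<close>

definition frn_mean_field ::
  "(real \<Rightarrow> real) \<Rightarrow> real \<Rightarrow> real \<Rightarrow> real \<Rightarrow> real \<Rightarrow> real ^ 'n \<Rightarrow> real ^ 'n \<Rightarrow>
   (nat \<Rightarrow> real) \<Rightarrow> (nat \<Rightarrow> real) \<Rightarrow> (nat \<Rightarrow> real) \<Rightarrow> (nat \<Rightarrow> real) \<Rightarrow> bool" where
  "frn_mean_field \<phi> \<sigma>v \<sigma>a \<sigma>w \<sigma>b x x' p q \<gamma> \<Lambda> \<longleftrightarrow>
     norm x = norm x' \<and>
     p 0 = (norm x)\<^sup>2 / CARD('n) \<and>
     \<gamma> 0 = (x \<bullet> x') / CARD('n) \<and>
     (\<forall>l\<ge>1.
        q l = \<sigma>w\<^sup>2 * p (l - 1) + \<sigma>b\<^sup>2 \<and>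
        p l = \<sigma>v\<^sup>2 * V \<phi> (q l) + \<sigma>a\<^sup>2 + p (l - 1) \<and>
        \<Lambda> l = \<sigma>w\<^sup>2 * \<gamma> (l - 1) + \<sigma>b\<^sup>2 \<and>
        \<gamma> l = \<sigma>v\<^sup>2 * W \<phi> (q l) (\<Lambda> l) + \<sigma>a\<^sup>2 + \<gamma> (l - 1))"

end

theory Submission
  imports Defs "HOL-Real_Asymp.Real_Asymp"
begin

text \<open>
  For the ReLU, \<open>V q = q / 2\<close> and, with \<open>\<epsilon> = 1 - \<nu> / \<rho>\<close>, \<open>W \<rho> \<nu> = \<rho> / 2 * (1 - \<epsilon> * (1 - g \<epsilon>))\<close> for an
  explicit \<open>g\<close> with \<open>0 < g \<le> 1\<close> on \<open>(0, 2]\<close> and \<open>g \<epsilon> \<sim> U * sqrt \<epsilon>\<close> at \<open>0\<close>. So \<open>p\<close> obeys an affine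
  recurrence with factor \<open>B\<close>, whence \<open>p l \<sim> K * B ^ l\<close>, and \<open>s\<close> is multiplied by
  \<open>B - (B - 1) * g (\<epsilon> l)\<close> in each layer. Dividing \<open>s\<close> by \<open>K * B ^ l\<close> instead of \<open>p l\<close> gives a sequence
  \<open>r\<close> that is equivalent to \<open>1 - e\<close> and to \<open>\<epsilon>\<close> and satisfies \<open>r (l + 1) = r l * (1 - \<kappa> * g (\<epsilon> l))\<close>
  exactly, where \<open>\<kappa> = (B - 1) / B\<close>. It decreases to \<open>0\<close>; the increments of \<open>1 / sqrt r\<close> then tend
  to \<open>\<kappa> * U / 2\<close>, and hence so does \<open>1 / (l * sqrt (r l))\<close>.
\<close>

section \<open>Gaussian integrals of the ReLU\<close>

lemma relu_measurable [measurable]: "relu \<in> borel_measurable borel"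
  unfolding relu_def by measurable

lemma relu_nonneg: "relu x \<ge> 0"
  by (simp add: relu_def)

lemma relu_mult_nonneg: "c \<ge> 0 \<Longrightarrow> relu (c * x) = c * relu x"
  by (simp add: relu_def max_mult_distrib_left)

text \<open>The Gaussian density is even and the squares of \<open>relu z\<close> and
  \<open>relu (- z)\<close> add up to \<open>z\<^sup>2\<close>, so for \<open>q = 1\<close> the
  integral is half the second moment. Homogeneity of \<open>relu\<close> extracts the factor
  \<open>q\<close>.\<close>

lemma V_relu:
  assumes "q \<ge> 0"
  shows "V relu q = q / 2"
proof -
  let ?d = "\<lambda>z::real. std_normal_density z * (relu z)\<^sup>2"
  have moment: "integrable lborel (\<lambda>z. std_normal_density z * z\<^sup>2)"
    using integrable_std_normal_moment[of 2] by simp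
  have int: "integrable lborel ?d"
    by (rule Bochner_Integration.integrable_bound[OF moment])
       (auto simp: relu_def max_def intro!: AE_I2)
  have int': "integrable lborel (\<lambda>z. ?d (- z))"
    by (rule Bochner_Integration.integrable_bound[OF moment])
       (auto simp: relu_def max_def normal_density_def intro!: AE_I2)
  have "(LINT z|lborel. ?d (- z)) = (LINT z|lborel. ?d z)"
    using lborel_integral_real_affine[of "-1" ?d 0] by simp
  hence "2 * (LINT z|lborel. ?d z) = (LINT z|lborel. ?d z + ?d (- z))"
    using int int' by simp
  also have "\<dots> = (LINT z|lborel. std_normal_density z * z^(2*1))"
    by (intro Bochner_Integration.integral_cong)
       (auto simp: relu_def max_def normal_density_def)
  also have "\<dots> = 1"
    by (subst integral_std_normal_moment_even) simp
  finally have half: "(LINT z|lborel. ?d z) = 1 / 2"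
    by simp
  have "V relu q = (LINT z|std_normal_distribution. (relu (sqrt q * z))\<^sup>2)"
    unfolding V_def gauss1_def by (subst integral_distr) auto
  also have "\<dots> = (LINT z|std_normal_distribution. q * (relu z)\<^sup>2)"
    using assms by (simp add: relu_mult_nonneg power_mult_distrib)
  also have "\<dots> = (LINT z|lborel. q * ?d z)"
    by (subst integral_density) (auto simp: ac_simps)
  finally show ?thesis
    using half by simp
qed

text \<open>The radial integral in the computation of \<open>W\<close>, used there with
  \<open>c = 1 + t\<^sup>2\<close>. The antiderivative \<open>?F\<close> comes from one integration
  by parts.\<close>

lemma nn_integral_cube_gaussian:
  fixes c :: real
  assumes "c > 0"
  shows "(\<integral>\<^sup>+ x. ennreal (x ^ 3 * exp (- (c * x\<^sup>2) / 2)) * indicator {0..} x \<partial>lborel)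
    = ennreal (2 / c\<^sup>2)"
proof -
  let ?F = "\<lambda>x::real. - ((x\<^sup>2 / c + 2 / c\<^sup>2) * exp (- (c * x\<^sup>2) / 2))"
  have "(\<integral>\<^sup>+ x. ennreal (x ^ 3 * exp (- (c * x\<^sup>2) / 2)) * indicator {0..} x \<partial>lborel)
      = ennreal (0 - ?F 0)"
  proof (rule nn_integral_FTC_atLeast)
    show "DERIV ?F x :> x ^ 3 * exp (- (c * x\<^sup>2) / 2)" for x
      using assms by (auto intro!: derivative_eq_intros simp: field_simps power2_eq_square power3_eq_cube)
    show "(?F \<longlongrightarrow> 0) at_top"
      using assms by real_asymp
  qed auto
  thus ?thesis by simp
qed

text \<open>In independent coordinates \<open>x\<close>, \<open>y\<close> the integrand is supported
  on the cone \<open>\<bar>b * y\<bar> \<le> a * x\<close>. Passing to the slope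
  \<open>t = y / x\<close> and integrating over \<open>x\<close> leaves a rational function on
  \<open>{-k..k}\<close> with an elementary antiderivative. The assumption
  \<open>\<nu> < \<rho>\<close> makes \<open>b\<close> positive, so the extreme slope
  \<open>k = a / b\<close> is finite.\<close>

lemma W_relu:
  assumes "\<bar>\<nu>\<bar> \<le> \<rho>" "\<nu> < \<rho>"
  shows "W relu \<rho> \<nu> =
    (\<nu> * arctan (sqrt ((\<rho> + \<nu>) / (\<rho> - \<nu>))) + sqrt (\<rho>\<^sup>2 - \<nu>\<^sup>2) / 2) / pi"
proof -
  let ?N = "std_normal_distribution"
  define a where "a = sqrt ((\<rho> + \<nu>) / 2)"
  define b where "b = sqrt ((\<rho> - \<nu>) / 2)"
  define k where "k = a / b"
  have a: "a \<ge> 0" and b: "b > 0" and k: "k \<ge> 0"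
    using assms by (auto simp: a_def b_def k_def)
  have sq: "a\<^sup>2 = (\<rho> + \<nu>) / 2" "b\<^sup>2 = (\<rho> - \<nu>) / 2"
    using assms by (auto simp: a_def b_def)
  have ab: "a * b = sqrt (\<rho>\<^sup>2 - \<nu>\<^sup>2) / 2"
    unfolding a_def b_def real_sqrt_mult[symmetric]
    by (simp add: power2_eq_square algebra_simps real_sqrt_divide)
  have k_eq: "k = sqrt ((\<rho> + \<nu>) / (\<rho> - \<nu>))"
    using assms by (simp add: k_def a_def b_def real_sqrt_divide)
  interpret N: real_distribution ?N by (rule real_dist_normal_dist)
  define f where "f = (\<lambda>x y. relu (a * x + b * y) * relu (a * x - b * y))"
  have f_meas [measurable]: "case_prod f \<in> borel_measurable (borel \<Otimes>\<^sub>M borel)"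
    unfolding f_def by measurable
  have f0: "f x y \<ge> 0" for x y
    by (simp add: f_def relu_nonneg)
  have f_neg: "f x y = 0" if "x \<le> 0" for x y
    using mult_nonneg_nonpos[OF a that] by (auto simp: f_def relu_def max_def)
  have f_scale: "f x (x * t) = x\<^sup>2 * f 1 t" if "x > 0" for x t
    using relu_mult_nonneg[of x "a + b * t"] relu_mult_nonneg[of x "a - b * t"] that
    by (simp add: f_def algebra_simps power2_eq_square)
  have f1: "f 1 t = (a\<^sup>2 - b\<^sup>2 * t\<^sup>2) * indicator {-k..k} t" for t
  proof (cases "t \<in> {-k..k}")
    case True
    hence "a + b * t \<ge> 0" "a - b * t \<ge> 0"
      using b by (auto simp: k_def field_simps)
    thus ?thesis using True
      by (simp add: f_def relu_def power2_eq_square algebra_simps)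
  next
    case False
    hence "a + b * t \<le> 0 \<or> a - b * t \<le> 0"
      using b by (auto simp: k_def field_simps)
    thus ?thesis using False
      by (auto simp: f_def relu_def)
  qed
  \<comment> \<open>Split \<open>a\<^sup>2 - b\<^sup>2 * t\<^sup>2\<close> into
    \<open>(a\<^sup>2 + b\<^sup>2) - b\<^sup>2 * (1 + t\<^sup>2)\<close> and use that
    \<open>1 / (1 + t\<^sup>2)\<^sup>2\<close> integrates to
    \<open>(arctan t + t / (1 + t\<^sup>2)) / 2\<close>. The function is odd, so its increment over
    \<open>{-k..k}\<close> is \<open>2 * F k\<close>.\<close>
  define F where "F = (\<lambda>t::real. ((a\<^sup>2 - b\<^sup>2) * arctan t + (a\<^sup>2 + b\<^sup>2) * t / (1 + t\<^sup>2)) / (2 * pi))"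
  have F_deriv: "DERIV F t :> (a\<^sup>2 - b\<^sup>2 * t\<^sup>2) / (pi * (1 + t\<^sup>2)\<^sup>2)" for t
  proof -
    have nz: "1 + t\<^sup>2 \<noteq> 0"
      using add_pos_nonneg[of 1 "t\<^sup>2"] by simp
    have "DERIV F t :> ((a\<^sup>2 - b\<^sup>2) * (1 / (1 + t\<^sup>2)) +
        ((a\<^sup>2 + b\<^sup>2) * (1 + t\<^sup>2) - (a\<^sup>2 + b\<^sup>2) * t * (2 * t)) / (1 + t\<^sup>2)\<^sup>2) / (2 * pi)"
      unfolding F_def
      by (rule DERIV_cdivide, rule DERIV_add)
         (use nz in \<open>auto intro!: derivative_eq_intros simp: inverse_eq_divide power2_eq_square\<close>)
    also have "((a\<^sup>2 - b\<^sup>2) * (1 / (1 + t\<^sup>2)) +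
        ((a\<^sup>2 + b\<^sup>2) * (1 + t\<^sup>2) - (a\<^sup>2 + b\<^sup>2) * t * (2 * t)) / (1 + t\<^sup>2)\<^sup>2) =
        2 * (a\<^sup>2 - b\<^sup>2 * t\<^sup>2) / (1 + t\<^sup>2)\<^sup>2"
      using nz by (simp add: divide_simps power2_eq_square) (simp add: algebra_simps)
    also have "2 * (a\<^sup>2 - b\<^sup>2 * t\<^sup>2) / (1 + t\<^sup>2)\<^sup>2 / (2 * pi) =
        (a\<^sup>2 - b\<^sup>2 * t\<^sup>2) / (pi * (1 + t\<^sup>2)\<^sup>2)"
      using nz by (simp add: divide_simps)
    finally show ?thesis .
  qed
  have F_diff: "F k - F (- k) = (\<nu> * arctan k + a * b) / pi"
  proof -
    have dbl: "2 * (N / (2 * pi)) = N / pi" for N :: real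
      by simp
    define z where "z = k / (1 + k\<^sup>2)"
    have Fk: "F k = ((a\<^sup>2 - b\<^sup>2) * arctan k + (a\<^sup>2 + b\<^sup>2) * z) / (2 * pi)"
      by (simp add: F_def z_def)
    have "F (- k) = ((a\<^sup>2 - b\<^sup>2) * (- arctan k) + (a\<^sup>2 + b\<^sup>2) * (- z)) / (2 * pi)"
      by (simp add: F_def z_def arctan_minus)
    also have "\<dots> = - F k"
      unfolding Fk by (simp only: mult_minus_right minus_divide_left minus_add_distrib)
    finally have "F k - F (- k) = 2 * F k"
      by simp
    also have "2 * F k = ((a\<^sup>2 - b\<^sup>2) * arctan k + (a\<^sup>2 + b\<^sup>2) * (k / (1 + k\<^sup>2))) / pi"
      unfolding Fk z_def by (rule dbl)
    also have "k / (1 + k\<^sup>2) = a * b / (a\<^sup>2 + b\<^sup>2)"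
      using b by (simp add: k_def divide_simps power2_eq_square)
    also have "(a\<^sup>2 + b\<^sup>2) * (a * b / (a\<^sup>2 + b\<^sup>2)) = a * b"
      using b add_nonneg_pos[of "a\<^sup>2" "b\<^sup>2"] by simp
    also have "a\<^sup>2 - b\<^sup>2 = \<nu>"
      by (simp add: sq field_simps)
    finally show ?thesis .
  qed
  \<comment> \<open>Needed at the end, where \<open>enn2real\<close> would turn a negative increment
    into 0.\<close>
  have F_mono: "F (- k) \<le> F k"
  proof (rule DERIV_nonneg_imp_nondecreasing[where f = F])
    fix t assume "- k \<le> t" "t \<le> k"
    hence "(a\<^sup>2 - b\<^sup>2 * t\<^sup>2) / (pi * (1 + t\<^sup>2)\<^sup>2) \<ge> 0"
      using f0[of 1 t] by (simp add: f1)
    with F_deriv show "\<exists>y. DERIV F t :> y \<and> y \<ge> 0" by blast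
  qed (use k in auto)
  \<comment> \<open>As \<open>f\<close> is nonnegative, \<open>nn_integral\<close> can be used
    throughout, and the order of integration can be exchanged without an integrability
    proof.\<close>
  have nn: "(\<integral>\<^sup>+ z. ennreal (case_prod f z) \<partial>(?N \<Otimes>\<^sub>M ?N)) =
      ennreal ((\<nu> * arctan k + a * b) / pi)"
  proof -
    have "(\<integral>\<^sup>+ z. ennreal (case_prod f z) \<partial>(?N \<Otimes>\<^sub>M ?N))
        = (\<integral>\<^sup>+ x. \<integral>\<^sup>+ y. ennreal (f x y) \<partial>?N \<partial>?N)"
      by (subst N.nn_integral_fst[symmetric]) auto
    also have "\<dots> = (\<integral>\<^sup>+ x. ennreal (std_normal_density x) *
        (\<integral>\<^sup>+ y. ennreal (std_normal_density y) * ennreal (f x y) \<partial>lborel) \<partial>lborel)"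
      by (simp add: nn_integral_density)
    txt \<open>The substitution \<open>y = x * t\<close> makes the integrand a product of a function of \<open>t\<close> and a
      Gaussian moment in \<open>x\<close>, as \<open>f\<close> is homogeneous of degree 2.\<close>
    also have "\<dots> = (\<integral>\<^sup>+ x. \<integral>\<^sup>+ t. ennreal (x ^ 3 * exp (- ((1 + t\<^sup>2) * x\<^sup>2) / 2)) *
        indicator {0..} x * ennreal (f 1 t / (2 * pi)) \<partial>lborel \<partial>lborel)"
    proof (rule nn_integral_cong)
      fix x :: real
      show "ennreal (std_normal_density x) *
          (\<integral>\<^sup>+ y. ennreal (std_normal_density y) * ennreal (f x y) \<partial>lborel) =
        (\<integral>\<^sup>+ t. ennreal (x ^ 3 * exp (- ((1 + t\<^sup>2) * x\<^sup>2) / 2)) *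
        indicator {0..} x * ennreal (f 1 t / (2 * pi)) \<partial>lborel)"
      proof (cases "x > 0")
        case True
        have "ennreal (std_normal_density x) *
            (\<integral>\<^sup>+ y. ennreal (std_normal_density y) * ennreal (f x y) \<partial>lborel) =
          ennreal (std_normal_density x) * (ennreal x *
            (\<integral>\<^sup>+ t. ennreal (std_normal_density (x * t)) * ennreal (f x (x * t)) \<partial>lborel))"
          using True
          by (subst nn_integral_real_affine[where c = x and t = 0]) auto
        also have "\<dots> = (\<integral>\<^sup>+ t. ennreal (std_normal_density x) * (ennreal x *
            (ennreal (std_normal_density (x * t)) * ennreal (f x (x * t)))) \<partial>lborel)"
          by (simp add: nn_integral_cmult)
        also have "\<dots> = (\<integral>\<^sup>+ t. ennreal (x ^ 3 * exp (- ((1 + t\<^sup>2) * x\<^sup>2) / 2)) *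
            indicator {0..} x * ennreal (f 1 t / (2 * pi)) \<partial>lborel)"
        proof (rule nn_integral_cong)
          fix t :: real
          have "std_normal_density x * (x * (std_normal_density (x * t) * f x (x * t))) =
            x ^ 3 * exp (- ((1 + t\<^sup>2) * x\<^sup>2) / 2) * (f 1 t / (2 * pi))"
            unfolding f_scale[OF True]
            by (simp add: normal_density_def real_sqrt_mult exp_add[symmetric] power3_eq_cube
                power2_eq_square field_simps)
          thus "ennreal (std_normal_density x) * (ennreal x *
              (ennreal (std_normal_density (x * t)) * ennreal (f x (x * t)))) =
            ennreal (x ^ 3 * exp (- ((1 + t\<^sup>2) * x\<^sup>2) / 2)) *
              indicator {0..} x * ennreal (f 1 t / (2 * pi))"
            using True f0 by (simp add: ennreal_mult[symmetric])
        qed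
        finally show ?thesis .
      next
        case False
        \<comment> \<open>At \<open>x = 0\<close> the indicator is 1 and it is the factor
          \<open>x ^ 3\<close> that vanishes.\<close>
        hence "ennreal (x ^ 3 * exp (- ((1 + t\<^sup>2) * x\<^sup>2) / 2)) * indicator {0..} x = 0" for t
          by (cases "x = 0") auto
        with False show ?thesis
          by (simp only: f_neg not_less ennreal_0 mult_zero_left mult_zero_right nn_integral_const)
      qed
    qed
    also have "\<dots> = (\<integral>\<^sup>+ t. \<integral>\<^sup>+ x. ennreal (x ^ 3 * exp (- ((1 + t\<^sup>2) * x\<^sup>2) / 2)) *
        indicator {0..} x * ennreal (f 1 t / (2 * pi)) \<partial>lborel \<partial>lborel)"
      by (rule lborel_pair.Fubini'[symmetric]) measurable
    also have "\<dots> = (\<integral>\<^sup>+ t. ennreal ((a\<^sup>2 - b\<^sup>2 * t\<^sup>2) / (pi * (1 + t\<^sup>2)\<^sup>2)) *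
        indicator {-k..k} t \<partial>lborel)"
    proof (rule nn_integral_cong)
      fix t :: real
      have pos: "1 + t\<^sup>2 > 0" by (simp add: add_pos_nonneg)
      have "(\<integral>\<^sup>+ x. ennreal (x ^ 3 * exp (- ((1 + t\<^sup>2) * x\<^sup>2) / 2)) *
          indicator {0..} x * ennreal (f 1 t / (2 * pi)) \<partial>lborel) =
          ennreal (2 / (1 + t\<^sup>2)\<^sup>2) * ennreal (f 1 t / (2 * pi))"
        by (subst nn_integral_multc) (auto simp only: nn_integral_cube_gaussian[OF pos], measurable)
      also have "\<dots> = ennreal ((a\<^sup>2 - b\<^sup>2 * t\<^sup>2) * indicator {-k..k} t / (pi * (1 + t\<^sup>2)\<^sup>2))"
        unfolding f1[symmetric] using f0[of 1 t] by (simp add: ennreal_mult[symmetric] field_simps)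
      also have "\<dots> = ennreal ((a\<^sup>2 - b\<^sup>2 * t\<^sup>2) / (pi * (1 + t\<^sup>2)\<^sup>2)) * indicator {-k..k} t"
        by (simp split: split_indicator)
      finally show "(\<integral>\<^sup>+ x. ennreal (x ^ 3 * exp (- ((1 + t\<^sup>2) * x\<^sup>2) / 2)) *
          indicator {0..} x * ennreal (f 1 t / (2 * pi)) \<partial>lborel) =
        ennreal ((a\<^sup>2 - b\<^sup>2 * t\<^sup>2) / (pi * (1 + t\<^sup>2)\<^sup>2)) * indicator {-k..k} t" .
    qed
    also have "\<dots> = ennreal (F k - F (- k))"
    proof (rule nn_integral_FTC_Icc)
      fix t assume t: "t \<in> {-k..k}"
      show "DERIV F t :> (a\<^sup>2 - b\<^sup>2 * t\<^sup>2) / (pi * (1 + t\<^sup>2)\<^sup>2)"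
        by (rule F_deriv)
      show "(a\<^sup>2 - b\<^sup>2 * t\<^sup>2) / (pi * (1 + t\<^sup>2)\<^sup>2) \<ge> 0"
        using f0[of 1 t] t by (simp add: f1)
    qed (use k in auto)
    also have "F k - F (- k) = (\<nu> * arctan k + a * b) / pi"
      by (rule F_diff)
    finally show ?thesis .
  qed
  have "W relu \<rho> \<nu> = (LINT z|(?N \<Otimes>\<^sub>M ?N). case_prod f z)"
    unfolding W_def gauss2_def f_def a_def b_def
    by (subst integral_distr) (auto simp: case_prod_unfold)
  also have "\<dots> = enn2real (\<integral>\<^sup>+ z. ennreal (case_prod f z) \<partial>(?N \<Otimes>\<^sub>M ?N))"
    by (rule integral_eq_nn_integral) (auto simp: f0 case_prod_beta)
  also have "\<dots> = (\<nu> * arctan k + a * b) / pi"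
    unfolding nn F_diff[symmetric] using F_mono by simp
  finally show ?thesis
    by (simp add: ab k_eq)
qed

text \<open>Here \<open>1 - \<epsilon>\<close> is the correlation of the two preactivations, and its arccosine the angle between them.\<close>

definition relu_gap :: "real \<Rightarrow> real" where
  "relu_gap \<epsilon> = (sin (arccos (1 - \<epsilon>)) - arccos (1 - \<epsilon>) * (1 - \<epsilon>)) / (pi * \<epsilon>)"

section \<open>The ReLU correlation map in terms of the angle\<close>

lemma arctan_sqrt_half_angle:
  assumes "0 < \<theta>" "\<theta> \<le> pi"
  shows "arctan (sqrt ((1 + cos \<theta>) / (1 - cos \<theta>))) = (pi - \<theta>) / 2"
proof -
  define h where "h = \<theta> / 2"
  have h: "0 < h" "h \<le> pi / 2" and \<theta>: "\<theta> = 2 * h"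
    using assms by (auto simp: h_def)
  have pos: "sin h > 0" "cos h \<ge> 0"
    using h by (auto intro: sin_gt_zero cos_ge_zero)
  \<comment> \<open>The half-angle formulas turn the root into the cotangent of \<open>h\<close>.
    Since \<open>0 < h \<le> pi / 2\<close>, the angle \<open>pi / 2 - h\<close> lies where
    \<open>arctan\<close> inverts \<open>tan\<close>.\<close>
  have "1 + cos \<theta> = 2 * (cos h)\<^sup>2" "1 - cos \<theta> = 2 * (sin h)\<^sup>2"
    unfolding \<theta> using cos_double_cos[of h] cos_double_sin[of h] by auto
  hence "sqrt ((1 + cos \<theta>) / (1 - cos \<theta>)) = cos h / sin h"
    using pos by (simp add: real_sqrt_divide)
  also have "\<dots> = tan (pi / 2 - h)"
    by (simp add: tan_def cos_diff sin_diff)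
  finally show ?thesis
    using h by (simp add: arctan_tan \<theta>)
qed

text \<open>This is the arc-cosine kernel of degree 1. In the angle \<open>\<theta>\<close> the
  arctangent of \<open>W_relu\<close> is \<open>(pi - \<theta>) / 2\<close> and the root is
  \<open>\<rho> * sin \<theta>\<close>. In this form the difference to
  \<open>V relu \<rho> = \<rho> / 2\<close> is
  \<open>\<rho> / 2 * \<epsilon> * (1 - relu_gap \<epsilon>)\<close>.\<close>

lemma W_relu_gap:
  assumes "\<bar>\<nu>\<bar> \<le> \<rho>" "\<nu> < \<rho>"
  defines "\<epsilon> \<equiv> (\<rho> - \<nu>) / \<rho>"
  shows "W relu \<rho> \<nu> = \<rho> / 2 * (1 - \<epsilon> * (1 - relu_gap \<epsilon>))"
proof -
  have \<rho>: "\<rho> > 0" using assms by linarith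
  define \<theta> where "\<theta> = arccos (1 - \<epsilon>)"
  have \<epsilon>: "0 < \<epsilon>" "\<epsilon> \<le> 2"
    using assms \<rho> by (auto simp: \<epsilon>_def field_simps)
  have \<theta>: "0 \<le> \<theta>" "\<theta> \<le> pi" "cos \<theta> = 1 - \<epsilon>"
    using \<epsilon> by (auto simp: \<theta>_def intro: arccos_lbound arccos_ubound)
  have "\<theta> \<noteq> 0" using \<theta> \<epsilon> by auto
  hence \<theta>0: "\<theta> > 0" using \<theta> by simp
  have \<nu>: "\<nu> = \<rho> * cos \<theta>"
    using \<rho> by (simp add: \<theta> \<epsilon>_def field_simps)
  have ratio: "(\<rho> + \<nu>) / (\<rho> - \<nu>) = (1 + cos \<theta>) / (1 - cos \<theta>)"
  proof -
    have "(\<rho> + \<nu>) / (\<rho> - \<nu>) = (\<rho> * (1 + cos \<theta>)) / (\<rho> * (1 - cos \<theta>))"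
      by (simp add: \<nu> algebra_simps)
    thus ?thesis using \<rho> by simp
  qed
  have "\<rho>\<^sup>2 - \<nu>\<^sup>2 = (\<rho> * sin \<theta>)\<^sup>2"
    by (simp add: \<nu> power_mult_distrib sin_squared_eq algebra_simps)
  hence root: "sqrt (\<rho>\<^sup>2 - \<nu>\<^sup>2) = \<rho> * sin \<theta>"
    using \<rho> \<theta> by (simp add: sin_ge_zero)
  have gap: "\<epsilon> * relu_gap \<epsilon> = (sin \<theta> - \<theta> * cos \<theta>) / pi"
    using \<epsilon> \<theta> by (simp add: relu_gap_def \<theta>_def)
  have "W relu \<rho> \<nu> = (\<rho> * cos \<theta> * ((pi - \<theta>) / 2) + \<rho> * sin \<theta> / 2) / pi"
    unfolding W_relu[OF assms(1,2)] ratio root arctan_sqrt_half_angle[OF \<theta>0 \<theta>(2)]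
    by (simp add: \<nu>)
  also have "\<dots> = \<rho> / 2 * (cos \<theta> + (sin \<theta> - \<theta> * cos \<theta>) / pi)"
    by (simp add: field_simps)
  also have "\<dots> = \<rho> / 2 * (1 - \<epsilon> * (1 - relu_gap \<epsilon>))"
    unfolding gap[symmetric] unfolding \<theta>(3) by (simp add: algebra_simps)
  finally show ?thesis .
qed

section \<open>Sign, size and behaviour at 0 of \<open>relu_gap\<close>\<close>

lemma sin_gt_mult_cos:
  assumes "0 < \<theta>" "\<theta> \<le> pi"
  shows "\<theta> * cos \<theta> < sin (\<theta>::real)"
proof -
  have "(\<lambda>t. sin t - t * cos t) 0 < (\<lambda>t. sin t - t * cos t) \<theta>"
  \<comment> \<open>The derivative \<open>t * sin t\<close> vanishes at 0 and at \<open>pi\<close>;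
    its positivity in the open interval suffices because of continuity.\<close>
  proof (rule DERIV_pos_imp_increasing_open[OF assms(1)])
    fix t assume t: "0 < t" "t < \<theta>"
    have "DERIV (\<lambda>t. sin t - t * cos t) t :> t * sin t"
      by (auto intro!: derivative_eq_intros)
    moreover have "t * sin t > 0"
      using t assms by (intro mult_pos_pos sin_gt_zero) auto
    ultimately show "\<exists>y. DERIV (\<lambda>t. sin t - t * cos t) t :> y \<and> y > 0" by blast
  qed (auto intro!: continuous_intros)
  thus ?thesis by simp
qed

text \<open>Equality holds at 0, and right side minus left side has derivative
  \<open>(pi - t) * sin t\<close>. This is the bound \<open>relu_gap \<epsilon> \<le> 1\<close>
  multiplied by \<open>pi * \<epsilon>\<close>.\<close>

lemma sin_minus_mult_cos_le:
  assumes "0 \<le> \<theta>" "\<theta> \<le> pi"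
  shows "sin \<theta> - \<theta> * cos \<theta> \<le> pi * (1 - cos (\<theta>::real))"
proof -
  let ?f = "\<lambda>t::real. pi * (1 - cos t) - (sin t - t * cos t)"
  have "?f 0 \<le> ?f \<theta>"
  proof (rule DERIV_nonneg_imp_nondecreasing[OF assms(1), where f = ?f])
    fix t assume t: "0 \<le> t" "t \<le> \<theta>"
    have "DERIV ?f t :> (pi - t) * sin t"
      by (auto intro!: derivative_eq_intros simp: algebra_simps)
    moreover have "(pi - t) * sin t \<ge> 0"
      using t assms by (intro mult_nonneg_nonneg sin_ge_zero) auto
    ultimately show "\<exists>y. DERIV ?f t :> y \<and> y \<ge> 0" by blast
  qed
  thus ?thesis by simp
qed

lemma arccos_one_minus:
  assumes "0 < \<epsilon>" "\<epsilon> \<le> 2"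
  shows "0 < arccos (1 - \<epsilon>)" "arccos (1 - \<epsilon>) \<le> pi" "cos (arccos (1 - \<epsilon>)) = 1 - \<epsilon>"
proof -
  show c: "cos (arccos (1 - \<epsilon>)) = 1 - \<epsilon>" and "arccos (1 - \<epsilon>) \<le> pi"
    using assms by (auto intro: arccos_ubound)
  have "arccos (1 - \<epsilon>) \<noteq> 0"
  proof
    assume "arccos (1 - \<epsilon>) = 0"
    with c have "1 - \<epsilon> = cos 0" by simp
    with assms show False by simp
  qed
  moreover have "arccos (1 - \<epsilon>) \<ge> 0" using assms by (intro arccos_lbound) auto
  ultimately show "0 < arccos (1 - \<epsilon>)" by simp
qed

lemma relu_gap_pos:
  assumes "0 < \<epsilon>" "\<epsilon> \<le> 2"
  shows "relu_gap \<epsilon> > 0"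
  using sin_gt_mult_cos[OF arccos_one_minus(1,2)[OF assms]] arccos_one_minus(3)[OF assms] assms
  by (simp add: relu_gap_def)

lemma relu_gap_le_1:
  assumes "0 < \<epsilon>" "\<epsilon> \<le> 2"
  shows "relu_gap \<epsilon> \<le> 1"
  using sin_minus_mult_cos_le[of "arccos (1 - \<epsilon>)"] arccos_one_minus[OF assms] assms
  by (simp add: relu_gap_def)

lemma continuous_on_relu_gap: "continuous_on {0<..2} relu_gap"
  unfolding relu_gap_def by (auto intro!: continuous_intros)

text \<open>For \<open>\<theta> = arccos (1 - \<epsilon>)\<close>, to leading order
  \<open>sin \<theta> - \<theta> * cos \<theta>\<close> is \<open>\<theta> ^ 3 / 3\<close> and
  \<open>\<epsilon>\<close> is \<open>\<theta>\<^sup>2 / 2\<close>. The quotient thus tends to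
  \<open>2 powr (3 / 2) / (3 * pi)\<close>.\<close>

lemma tendsto_relu_gap_0:
  "((\<lambda>\<epsilon>. relu_gap \<epsilon> / sqrt \<epsilon>) \<longlongrightarrow> 2 * sqrt 2 / (3 * pi)) (at_right 0)"
proof -
  have ev: "eventually (\<lambda>\<epsilon>::real. 0 < \<epsilon> \<and> \<epsilon> \<le> 2) (at_right 0)"
    using eventually_at_right_less[of 0] eventually_at_right_field by (force intro: exI[of _ 2])
  have "continuous_on {0..2} (\<lambda>\<epsilon>::real. arccos (1 - \<epsilon>))"
    by (auto intro!: continuous_intros)
  hence "((\<lambda>\<epsilon>. arccos (1 - \<epsilon>)) \<longlongrightarrow> arccos (1 - 0)) (at (0::real) within {0..2})"
    unfolding continuous_on_def by (rule bspec) simp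
  hence "((\<lambda>\<epsilon>. arccos (1 - \<epsilon>)) \<longlongrightarrow> 0) (at_right (0::real))"
    by (simp add: at_within_Icc_at_right)
  hence lim: "filterlim (\<lambda>\<epsilon>. arccos (1 - \<epsilon>)) (at_right 0) (at_right (0::real))"
    by (rule tendsto_imp_filterlim_at_right)
       (use ev in \<open>auto elim!: eventually_mono intro: arccos_one_minus\<close>)
  have "((\<lambda>\<theta>::real. (sin \<theta> - \<theta> * cos \<theta>) / (pi * (1 - cos \<theta>)) / sqrt (1 - cos \<theta>)) \<longlongrightarrow>
      2 * sqrt 2 / (3 * pi)) (at_right 0)"
    by real_asymp (simp add: powr_half_sqrt real_sqrt_divide field_simps)
  from filterlim_compose[OF this lim] show ?thesis
    by (rule Lim_transform_eventually)
       (use ev in \<open>auto elim!: eventually_mono simp: relu_gap_def arccos_one_minus\<close>)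
qed

section \<open>Decay of the recurrence\<close>

text \<open>Cesaro averaging: \<open>y n - y 0\<close> is the sum of the first \<open>n\<close>
  increments.\<close>

lemma tendsto_div_real_of_increments:
  fixes y :: "nat \<Rightarrow> real"
  assumes "(\<lambda>n. y (Suc n) - y n) \<longlonglongrightarrow> L"
  shows "(\<lambda>n. y n / real n) \<longlonglongrightarrow> L"
proof (rule LIMSEQ_I)
  fix r :: real assume r: "r > 0"
  obtain N where N: "\<And>n. n \<ge> N \<Longrightarrow> norm (y (Suc n) - y n - L) < r / 2"
    using LIMSEQ_D[OF assms, of "r / 2"] r by auto
  have bound: "\<bar>y (N + k) - y N - real k * L\<bar> \<le> real k * (r / 2)" for k
  proof (induction k)
    case (Suc k)
    have "y (N + Suc k) - y N - real (Suc k) * L =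
        (y (N + k) - y N - real k * L) + (y (Suc (N + k)) - y (N + k) - L)"
      "real (Suc k) * (r / 2) = real k * (r / 2) + r / 2"
      by (simp_all add: algebra_simps)
    thus ?case using Suc N[of "N + k"] unfolding real_norm_def by linarith
  qed simp
  have "(\<lambda>n. \<bar>y N - real N * L\<bar> / real n) \<longlonglongrightarrow> 0"
    by real_asymp
  then obtain M where M: "\<And>n. n \<ge> M \<Longrightarrow> \<bar>y N - real N * L\<bar> / real n < r / 2"
    using LIMSEQ_D[of _ 0 "r / 2"] r by fastforce
  show "\<exists>n0. \<forall>n\<ge>n0. norm (y n / real n - L) < r"
  proof (intro exI allI impI)
    fix n assume n: "n \<ge> max 1 (max M N)"
    hence pos: "real n > 0" by auto
    \<comment> \<open>The first term collects an error below \<open>r / 2\<close> for each step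
      after \<open>N\<close>; the second is a fixed offset that becomes small after division by
      \<open>n\<close>.\<close>
    have "\<bar>y n - real n * L\<bar> \<le> \<bar>y n - y N - real (n - N) * L\<bar> + \<bar>y N - real N * L\<bar>"
      using n by (simp add: of_nat_diff algebra_simps)
    also have "\<bar>y n - y N - real (n - N) * L\<bar> \<le> real (n - N) * (r / 2)"
      using bound[of "n - N"] n by simp
    also have "\<dots> \<le> real n * (r / 2)"
      using r by (intro mult_right_mono) auto
    also have "\<bar>y N - real N * L\<bar> < real n * (r / 2)"
      using M[of n] n pos by (simp add: field_simps)
    finally have "\<bar>y n - real n * L\<bar> < r * real n"
      by (simp add: mult.commute)
    moreover have "y n / real n - L = (y n - real n * L) / real n"
      using pos by (simp add: field_simps)
    ultimately show "norm (y n / real n - L) < r"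
      using pos by (simp add: abs_divide pos_divide_less_eq)
  qed
qed

text \<open>As \<open>g t\<close> behaves like \<open>c * sqrt t\<close>, this is a discrete form of
  the equation \<open>r' = - \<kappa> * c * r powr (3 / 2)\<close>, along which
  \<open>1 / sqrt r\<close> grows at the constant rate \<open>\<kappa> * c / 2\<close>. The argument
  of \<open>g\<close> is a separate sequence \<open>\<epsilon>\<close>, only equivalent to
  \<open>r\<close>, since the network supplies \<open>\<epsilon>\<close> while the product
  recurrence is exact for \<open>r\<close>.\<close>

lemma recurrence_decay:
  fixes r \<epsilon> :: "nat \<Rightarrow> real" and g :: "real \<Rightarrow> real"
  assumes \<kappa>: "0 < \<kappa>" "\<kappa> < 1" and c: "c > 0"
    and g_pos: "\<And>t. 0 < t \<Longrightarrow> t \<le> M \<Longrightarrow> g t > 0"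
    and g_le: "\<And>t. 0 < t \<Longrightarrow> t \<le> M \<Longrightarrow> g t \<le> 1"
    and g_cont: "continuous_on {0<..M} g"
    and g_lim: "((\<lambda>t. g t / sqrt t) \<longlongrightarrow> c) (at_right 0)"
    and r0: "r 0 > 0"
    and \<epsilon>: "\<And>n. 0 < \<epsilon> n" "\<And>n. \<epsilon> n \<le> M"
    and rec: "\<And>n. r (Suc n) = r n * (1 - \<kappa> * g (\<epsilon> n))"
    and ratio: "(\<lambda>n. \<epsilon> n / r n) \<longlonglongrightarrow> 1"
  shows "r \<longlonglongrightarrow> 0" and "(\<lambda>n. r n * (\<kappa> * c / 2 * real n)\<^sup>2) \<longlonglongrightarrow> 1"
proof -
  have factor: "0 < 1 - \<kappa> * g (\<epsilon> n)" "1 - \<kappa> * g (\<epsilon> n) < 1" for n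
  proof -
    have "\<kappa> * g (\<epsilon> n) \<le> \<kappa> * 1"
      using \<kappa> g_le[OF \<epsilon>] by (intro mult_left_mono) auto
    thus "0 < 1 - \<kappa> * g (\<epsilon> n)" using \<kappa> by linarith
    show "1 - \<kappa> * g (\<epsilon> n) < 1" using \<kappa> g_pos[OF \<epsilon>] by simp
  qed
  have r_pos: "r n > 0" for n
    by (induction n) (use r0 factor in \<open>auto simp: rec simp del: diff_gt_0_iff_gt intro!: mult_pos_pos\<close>)
  have "decseq r"
    unfolding decseq_Suc_iff rec using factor r_pos by (simp add: mult_le_cancel_left1 less_imp_le)
  then obtain L where L: "r \<longlonglongrightarrow> L"
    using decseq_convergent[of r 0] r_pos less_imp_le by metis
  have L0: "L \<ge> 0"
    by (rule LIMSEQ_le_const[OF L]) (use r_pos less_imp_le in auto)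
  have "(\<lambda>n. \<epsilon> n / r n * r n) \<longlonglongrightarrow> 1 * L"
    by (intro tendsto_intros ratio L)
  moreover have "\<epsilon> n / r n * r n = \<epsilon> n" for n
    using r_pos[of n] by simp
  ultimately have \<epsilon>_lim: "\<epsilon> \<longlonglongrightarrow> L"
    by simp
  \<comment> \<open>A positive limit would satisfy \<open>g L = 0\<close>. As
    \<open>\<epsilon>\<close> has the same limit, \<open>L\<close> would lie in
    \<open>{0<..M}\<close>, where \<open>g\<close> is continuous and positive.\<close>
  have "L = 0"
  proof (rule ccontr)
    assume "L \<noteq> 0"
    with L0 have pos: "L > 0" by simp
    have LM: "L \<le> M"
      by (rule LIMSEQ_le_const2[OF \<epsilon>_lim]) (use \<epsilon> in auto)
    have "(\<lambda>n. g (\<epsilon> n)) \<longlonglongrightarrow> g L"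
      by (rule continuous_on_tendsto_compose[OF g_cont \<epsilon>_lim]) (use pos LM \<epsilon> in auto)
    hence "(\<lambda>n. r (Suc n)) \<longlonglongrightarrow> L * (1 - \<kappa> * g L)"
      unfolding rec by (intro tendsto_intros L)
    moreover have "(\<lambda>n. r (Suc n)) \<longlonglongrightarrow> L"
      using L by (rule LIMSEQ_Suc)
    ultimately have "L = L * (1 - \<kappa> * g L)"
      by (rule LIMSEQ_unique[symmetric])
    thus False using pos \<kappa> g_pos[OF pos LM] by (simp add: algebra_simps)
  qed
  with L \<epsilon>_lim have r_lim: "r \<longlonglongrightarrow> 0" and \<epsilon>_0: "\<epsilon> \<longlonglongrightarrow> 0"
    by auto
  from r_lim show "r \<longlonglongrightarrow> 0" .
  have \<epsilon>_right: "filterlim \<epsilon> (at_right 0) sequentially"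
    by (rule tendsto_imp_filterlim_at_right[OF \<epsilon>_0]) (use \<epsilon> in auto)
  have "(\<lambda>n. g (\<epsilon> n) / sqrt (\<epsilon> n) * sqrt (\<epsilon> n / r n)) \<longlonglongrightarrow> c * sqrt 1"
    by (intro tendsto_intros ratio filterlim_compose[OF g_lim \<epsilon>_right])
  moreover have "g (\<epsilon> n) / sqrt (\<epsilon> n) * sqrt (\<epsilon> n / r n) = g (\<epsilon> n) / sqrt (r n)" for n
    using \<epsilon>[of n] by (simp add: real_sqrt_divide)
  ultimately have g_r: "(\<lambda>n. g (\<epsilon> n) / sqrt (r n)) \<longlonglongrightarrow> c"
    by simp
  have "(\<lambda>n. g (\<epsilon> n) / sqrt (r n) * sqrt (r n)) \<longlonglongrightarrow> c * sqrt 0"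
    by (intro tendsto_intros g_r r_lim)
  moreover have "g (\<epsilon> n) / sqrt (r n) * sqrt (r n) = g (\<epsilon> n)" for n
    using r_pos[of n] by simp
  ultimately have "(\<lambda>n. g (\<epsilon> n)) \<longlonglongrightarrow> 0"
    by simp
  hence g_right: "filterlim (\<lambda>n. g (\<epsilon> n)) (at_right 0) sequentially"
    by (rule tendsto_imp_filterlim_at_right) (use g_pos \<epsilon> in auto)
  \<comment> \<open>The limit is the derivative of \<open>1 / sqrt (1 - \<kappa> * t)\<close> at
    0.\<close>
  have "((\<lambda>t. (1 / sqrt (1 - \<kappa> * t) - 1) / t) \<longlongrightarrow> \<kappa> / 2) (at_right 0)"
    using \<kappa> by real_asymp
  from tendsto_mult[OF filterlim_compose[OF this g_right] g_r]
  have incr: "(\<lambda>n. (1 / sqrt (1 - \<kappa> * g (\<epsilon> n)) - 1) / g (\<epsilon> n) * (g (\<epsilon> n) / sqrt (r n)))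
      \<longlonglongrightarrow> \<kappa> / 2 * c" .
  have "(1 / sqrt (1 - \<kappa> * g (\<epsilon> n)) - 1) / g (\<epsilon> n) * (g (\<epsilon> n) / sqrt (r n)) =
      1 / sqrt (r (Suc n)) - 1 / sqrt (r n)" for n
  proof -
    have "g (\<epsilon> n) \<noteq> 0" using g_pos[OF \<epsilon>, of n] by simp
    thus ?thesis
      unfolding rec real_sqrt_mult using factor[of n] r_pos[of n] by (simp add: field_simps)
  qed
  with incr have "(\<lambda>n. 1 / sqrt (r (Suc n)) - 1 / sqrt (r n)) \<longlonglongrightarrow> \<kappa> * c / 2"
    by simp
  hence "(\<lambda>n. 1 / sqrt (r n) / real n) \<longlonglongrightarrow> \<kappa> * c / 2"
    by (rule tendsto_div_real_of_increments)
  from tendsto_divide[OF tendsto_const[of "(\<kappa> * c / 2)\<^sup>2"] tendsto_power[OF this, of 2]]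
  have "(\<lambda>n. (\<kappa> * c / 2)\<^sup>2 / (1 / sqrt (r n) / real n)\<^sup>2) \<longlonglongrightarrow> (\<kappa> * c / 2)\<^sup>2 / (\<kappa> * c / 2)\<^sup>2"
    using \<kappa> c by simp
  \<comment> \<open>At \<open>n = 0\<close> both sides are 0, because division by zero yields
    0.\<close>
  moreover have "(\<kappa> * c / 2)\<^sup>2 / (1 / sqrt (r n) / real n)\<^sup>2 = r n * (\<kappa> * c / 2 * real n)\<^sup>2" for n
    using r_pos[of n] by (simp add: power_divide power_mult_distrib)
  ultimately show "(\<lambda>n. r n * (\<kappa> * c / 2 * real n)\<^sup>2) \<longlonglongrightarrow> 1"
    using \<kappa> c by simp
qed

section \<open>The mean-field recurrence\<close>

lemma W_relu_nonneg: "W relu \<rho> \<nu> \<ge> 0"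
  unfolding W_def by (intro Bochner_Integration.integral_nonneg) (auto simp: relu_nonneg)

lemma affine_recurrence:
  fixes p :: "nat \<Rightarrow> real"
  assumes "B \<noteq> 1" "\<And>n. p (Suc n) = B * p n + C"
  shows "p n = (p 0 + C / (B - 1)) * B ^ n - C / (B - 1)"
proof (induction n)
  case (Suc n)
  define D where "D = C / (B - 1)"
  have "C = (B - 1) * D"
    using assms(1) by (simp add: D_def)
  thus ?case
    unfolding assms(2) Suc D_def[symmetric] by (simp add: algebra_simps)
qed simp

text \<open>Induction on \<open>P\<close>: the bound \<open>\<bar>\<gamma> l\<bar> \<le> p l\<close>
  makes the next covariance matrix admissible, and \<open>\<gamma> l < p l\<close> keeps
  \<open>\<epsilon> l\<close> positive. The difference \<open>p - \<gamma>\<close> is multiplied by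
  a factor because the increment contains \<open>Q * \<epsilon> l\<close>, which equals
  \<open>\<sigma>w\<^sup>2 * (p l - \<gamma> l)\<close>.\<close>

lemma frn_relu_invariant:
  fixes x x' :: "real ^ 'n"
  assumes "frn_mean_field relu \<sigma>v \<sigma>a \<sigma>w \<sigma>b x x' p q \<gamma> \<Lambda>"
    and "\<sigma>w \<noteq> 0" "x \<noteq> x'"
  defines "\<epsilon> \<equiv> (\<lambda>l. \<sigma>w\<^sup>2 * (p l - \<gamma> l) / (\<sigma>w\<^sup>2 * p l + \<sigma>b\<^sup>2))"
    and "B \<equiv> 1 + \<sigma>v\<^sup>2 * \<sigma>w\<^sup>2 / 2"
  shows "p l > 0" and "\<gamma> l < p l" and "0 < \<epsilon> l" and "\<epsilon> l \<le> 2"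
    and "p (Suc l) = B * p l + (\<sigma>v\<^sup>2 * \<sigma>b\<^sup>2 / 2 + \<sigma>a\<^sup>2)"
    and "p (Suc l) - \<gamma> (Suc l) = (p l - \<gamma> l) * (B - (B - 1) * relu_gap (\<epsilon> l))"
proof -
  define P where "P = (\<lambda>l. p l > 0 \<and> \<bar>\<gamma> l\<bar> \<le> p l \<and> \<gamma> l < p l)"
  have q: "q (Suc l) = \<sigma>w\<^sup>2 * p l + \<sigma>b\<^sup>2" and p: "p (Suc l) = \<sigma>v\<^sup>2 * V relu (q (Suc l)) + \<sigma>a\<^sup>2 + p l"
    and \<Lambda>: "\<Lambda> (Suc l) = \<sigma>w\<^sup>2 * \<gamma> l + \<sigma>b\<^sup>2"
    and \<gamma>: "\<gamma> (Suc l) = \<sigma>v\<^sup>2 * W relu (q (Suc l)) (\<Lambda> (Suc l)) + \<sigma>a\<^sup>2 + \<gamma> l" for l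
    using assms(1) unfolding frn_mean_field_def by (auto dest!: spec[of _ "Suc l"])
  have w: "\<sigma>w\<^sup>2 > 0" using assms by simp
  have step: "0 < \<epsilon> l \<and> \<epsilon> l \<le> 2 \<and> p (Suc l) = B * p l + (\<sigma>v\<^sup>2 * \<sigma>b\<^sup>2 / 2 + \<sigma>a\<^sup>2) \<and>
      p (Suc l) - \<gamma> (Suc l) = (p l - \<gamma> l) * (B - (B - 1) * relu_gap (\<epsilon> l)) \<and> P (Suc l)"
    if "P l" for l
  proof -
    define Q where "Q = q (Suc l)"
    have pl: "p l > 0" "\<bar>\<gamma> l\<bar> \<le> p l" "\<gamma> l < p l"
      using that by (auto simp: P_def)
    have Q: "Q = \<sigma>w\<^sup>2 * p l + \<sigma>b\<^sup>2" "Q > 0"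
      using w pl by (auto simp: Q_def q intro: add_pos_nonneg)
    have d: "Q - \<Lambda> (Suc l) = \<sigma>w\<^sup>2 * (p l - \<gamma> l)"
      by (simp add: Q \<Lambda> algebra_simps)
    have lt: "\<Lambda> (Suc l) < Q"
      using d mult_pos_pos[OF w, of "p l - \<gamma> l"] pl by simp
    have "0 \<le> p l + \<gamma> l"
      using pl by linarith
    \<comment> \<open>The right side is \<open>Q + \<Lambda> (Suc l)\<close>, so this is the lower
      half of the bound on \<open>\<Lambda> (Suc l)\<close>.\<close>
    hence "0 \<le> \<sigma>w\<^sup>2 * (p l + \<gamma> l) + 2 * \<sigma>b\<^sup>2"
      by simp
    hence le: "\<bar>\<Lambda> (Suc l)\<bar> \<le> Q"
      using lt by (simp add: abs_le_iff Q \<Lambda> algebra_simps)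
    have \<epsilon>: "\<epsilon> l = (Q - \<Lambda> (Suc l)) / Q"
      by (simp only: \<epsilon>_def d) (simp add: Q(1))
    have Q\<epsilon>: "Q * \<epsilon> l = \<sigma>w\<^sup>2 * (p l - \<gamma> l)"
      using Q(2) by (simp add: \<epsilon> d)
    have \<epsilon>_bounds: "0 < \<epsilon> l" "\<epsilon> l \<le> 2"
      unfolding \<epsilon> using lt le Q(2) by (auto simp: pos_divide_le_eq)
    have pS: "p (Suc l) = \<sigma>v\<^sup>2 * (Q / 2) + \<sigma>a\<^sup>2 + p l"
      using p[of l] V_relu[of Q] Q(2) by (simp add: Q_def)
    have pS': "p (Suc l) = B * p l + (\<sigma>v\<^sup>2 * \<sigma>b\<^sup>2 / 2 + \<sigma>a\<^sup>2)"
      unfolding pS Q(1) B_def by (simp add: algebra_simps)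
    have \<gamma>S: "\<gamma> (Suc l) = \<sigma>v\<^sup>2 * (Q / 2 * (1 - \<epsilon> l * (1 - relu_gap (\<epsilon> l)))) + \<sigma>a\<^sup>2 + \<gamma> l"
      using \<gamma>[of l] W_relu_gap[OF le lt] by (simp add: \<epsilon> Q_def)
    have "p (Suc l) - \<gamma> (Suc l) =
        p l - \<gamma> l + \<sigma>v\<^sup>2 / 2 * (Q * \<epsilon> l) * (1 - relu_gap (\<epsilon> l))"
      unfolding pS \<gamma>S by (simp add: field_simps)
    also have "\<dots> = (p l - \<gamma> l) * (B - (B - 1) * relu_gap (\<epsilon> l))"
      unfolding Q\<epsilon> B_def by (simp add: field_simps)
    finally have sS: "p (Suc l) - \<gamma> (Suc l) = (p l - \<gamma> l) * (B - (B - 1) * relu_gap (\<epsilon> l))" .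
    have "1 + (B - 1) * (1 - relu_gap (\<epsilon> l)) > 0"
      using relu_gap_le_1[OF \<epsilon>_bounds] by (intro add_pos_nonneg mult_nonneg_nonneg) (auto simp: B_def)
    hence "B - (B - 1) * relu_gap (\<epsilon> l) > 0"
      by (simp add: algebra_simps)
    hence "p (Suc l) - \<gamma> (Suc l) > 0"
      unfolding sS using pl by (intro mult_pos_pos) auto
    \<comment> \<open>Both \<open>p\<close> and \<open>\<gamma>\<close> are nondecreasing in the
      layer, so \<open>- p \<le> \<gamma>\<close> persists; the upper bound on
      \<open>\<gamma>\<close> is the strict inequality just shown.\<close>
    moreover have "p (Suc l) \<ge> p l"
      unfolding pS using Q(2) by simp
    moreover have "\<gamma> (Suc l) \<ge> \<gamma> l"
      unfolding \<gamma> using W_relu_nonneg by simp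
    ultimately have "P (Suc l)"
      unfolding P_def using pl by (auto simp: abs_le_iff)
    thus ?thesis using \<epsilon>_bounds pS' sS by blast
  qed
  \<comment> \<open>Two different vectors of equal norm are nonzero, and their inner product is
    strictly below the squared norm.\<close>
  have "P 0"
  proof -
    have nrm: "norm x = norm x'" and p0: "p 0 = (norm x)\<^sup>2 / CARD('n)"
      and \<gamma>0: "\<gamma> 0 = (x \<bullet> x') / CARD('n)"
      using assms(1) by (auto simp: frn_mean_field_def)
    have "norm x > 0"
      using nrm assms(3) by (metis norm_eq_zero zero_less_norm_iff)
    moreover have "\<bar>x \<bullet> x'\<bar> \<le> (norm x)\<^sup>2"
      using Cauchy_Schwarz_ineq2[of x x'] by (simp add: nrm power2_eq_square)
    moreover have "x \<bullet> x' < (norm x)\<^sup>2"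
    proof -
      have "0 < (norm (x - x'))\<^sup>2"
        using assms(3) by simp
      also have "\<dots> = (norm x)\<^sup>2 + (norm x')\<^sup>2 - 2 * (x \<bullet> x')"
        by (simp add: power2_norm_eq_inner inner_diff inner_commute)
      finally show ?thesis using nrm by simp
    qed
    ultimately show ?thesis
      by (simp add: P_def p0 \<gamma>0 divide_right_mono divide_strict_right_mono)
  qed
  hence "P l" for l
    by (induction l) (use step in auto)
  with step[of l] show "p l > 0" "\<gamma> l < p l" "0 < \<epsilon> l" "\<epsilon> l \<le> 2"
    "p (Suc l) = B * p l + (\<sigma>v\<^sup>2 * \<sigma>b\<^sup>2 / 2 + \<sigma>a\<^sup>2)"
    "p (Suc l) - \<gamma> (Suc l) = (p l - \<gamma> l) * (B - (B - 1) * relu_gap (\<epsilon> l))"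
    by (auto simp: P_def)
qed

section \<open>Asymptotics of the ReLU residual network\<close>

theorem theoremB17:
  fixes \<sigma>v \<sigma>a \<sigma>w \<sigma>b B U :: real
    and x x' :: "real ^ 'n"
    and p q \<gamma> \<Lambda> e s :: "nat \<Rightarrow> real"
  assumes "\<sigma>v > 0" and "\<sigma>w > 0" and "\<sigma>a \<ge> 0" and "\<sigma>b \<ge> 0"
    and "x \<noteq> x'"
    and "frn_mean_field relu \<sigma>v \<sigma>a \<sigma>w \<sigma>b x x' p q \<gamma> \<Lambda>"
    and "\<And>l. e l = \<gamma> l / p l"
    and "\<And>l. s l = p l - \<gamma> l"
    and "B = 1 + \<sigma>v\<^sup>2 * \<sigma>w\<^sup>2 / 2"
    and "U = 2 * sqrt 2 / (3 * pi)"
  shows "e \<longlonglongrightarrow> 1 \<and>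
    (\<lambda>l. 1 - e l) \<sim>[sequentially]
      (\<lambda>l. (1 / 4 * \<sigma>v\<^sup>2 * \<sigma>w\<^sup>2 * inverse B * U * real l) powi (-2)) \<and>
    (\<forall>l. s l = (1 - e l) * p l) \<and>
    (\<exists>t \<in> \<Theta>(\<lambda>l. real l). s \<in> \<Theta>(\<lambda>l. real l powi (-2) * exp (t l))) \<and>
    (\<exists>t \<in> \<Theta>(\<lambda>l. real l). \<forall>l. s l = exp (t l))"
proof -
  define \<epsilon> where "\<epsilon> l = \<sigma>w\<^sup>2 * (p l - \<gamma> l) / (\<sigma>w\<^sup>2 * p l + \<sigma>b\<^sup>2)" for l
  define C where "C = \<sigma>v\<^sup>2 * \<sigma>b\<^sup>2 / 2 + \<sigma>a\<^sup>2"
  \<comment> \<open>The affine recurrence of \<open>p\<close> has the fixed point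
    \<open>- C / (B - 1)\<close>; \<open>K\<close> is the initial distance from it and hence the
    coefficient of \<open>B ^ l\<close>.\<close>
  define K where "K = p 0 + C / (B - 1)"
  define r where "r = (\<lambda>l. s l / (K * B ^ l))"
  define \<kappa> where "\<kappa> = (B - 1) / B"
  have \<sigma>w: "\<sigma>w \<noteq> 0" using assms by simp
  note inv = frn_relu_invariant[OF assms(6) \<sigma>w assms(5), folded \<epsilon>_def C_def assms(9), folded assms(8)]
  have s_pos: "s l > 0" for l
    using inv(2)[of l] by (simp add: assms(8))
  have B: "B > 1" and C: "C \<ge> 0"
    using assms by (auto simp: C_def)
  have K: "K > 0"
    unfolding K_def using inv(1)[of 0] B C by (intro add_pos_nonneg) auto
  have U: "U > 0"
    by (simp add: assms(10))
  have \<kappa>: "0 < \<kappa>" "\<kappa> < 1"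
    using B by (auto simp: \<kappa>_def)
  have KB: "K * B ^ l > 0" for l
    using K B by simp
  have p_eq: "p l = K * B ^ l - C / (B - 1)" for l
    unfolding K_def by (rule affine_recurrence) (use B inv(5) in auto)
  have p_lim: "(\<lambda>l. p l / (K * B ^ l)) \<longlonglongrightarrow> 1"
    unfolding p_eq using B K by real_asymp
  have \<epsilon>_lim: "(\<lambda>l. \<epsilon> l / r l) \<longlonglongrightarrow> 1"
  proof -
    \<comment> \<open>The quotient \<open>\<epsilon> l / r l\<close> after \<open>s l\<close> has
      cancelled; the additive constants are negligible against \<open>B ^ l\<close>.\<close>
    have "(\<lambda>l. \<sigma>w\<^sup>2 * (K * B ^ l) / (\<sigma>w\<^sup>2 * (K * B ^ l - C / (B - 1)) + \<sigma>b\<^sup>2)) \<longlonglongrightarrow> 1"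
      using B K assms(2) by real_asymp (simp add: field_simps)
    also have "(\<lambda>l. \<sigma>w\<^sup>2 * (K * B ^ l) / (\<sigma>w\<^sup>2 * (K * B ^ l - C / (B - 1)) + \<sigma>b\<^sup>2)) = (\<lambda>l. \<epsilon> l / r l)"
      unfolding p_eq[symmetric] using s_pos by (auto simp: fun_eq_iff \<epsilon>_def r_def assms(8)[symmetric] less_imp_neq[symmetric])
    finally show ?thesis .
  qed
  have decay: "r \<longlonglongrightarrow> 0" "(\<lambda>l. r l * (\<kappa> * U / 2 * real l)\<^sup>2) \<longlonglongrightarrow> 1"
  proof -
    have r0: "r 0 > 0"
      using s_pos[of 0] K by (simp add: r_def)
    have rec: "r (Suc l) = r l * (1 - \<kappa> * relu_gap (\<epsilon> l))" for l
    proof -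
      have "r (Suc l) = s l / (K * B ^ l) * ((B - (B - 1) * relu_gap (\<epsilon> l)) / B)"
        by (simp add: r_def inv(6))
      also have "(B - (B - 1) * relu_gap (\<epsilon> l)) / B = 1 - \<kappa> * relu_gap (\<epsilon> l)"
        using B by (simp add: \<kappa>_def field_simps)
      finally show ?thesis by (simp add: r_def)
    qed
    show "r \<longlonglongrightarrow> 0" "(\<lambda>l. r l * (\<kappa> * U / 2 * real l)\<^sup>2) \<longlonglongrightarrow> 1"
      using recurrence_decay[OF \<kappa> U relu_gap_pos relu_gap_le_1 continuous_on_relu_gap
          tendsto_relu_gap_0[folded assms(10)] r0 inv(3) inv(4) rec \<epsilon>_lim] by auto
  qed
  have one_minus_e: "1 - e l = s l / p l" and sep: "s l = (1 - e l) * p l" for l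
    using inv(1)[of l] by (simp_all add: assms(7,8) field_simps)
  have e_ratio: "(\<lambda>l. (1 - e l) / r l) \<longlonglongrightarrow> 1"
  proof -
    have "(\<lambda>l. 1 / (p l / (K * B ^ l))) \<longlonglongrightarrow> 1 / 1"
      by (intro tendsto_intros p_lim) auto
    moreover have "1 / (p l / (K * B ^ l)) = (1 - e l) / r l" for l
      using s_pos[of l] by (simp add: one_minus_e r_def)
    ultimately show ?thesis by simp
  qed
  have r_pos: "r l > 0" for l
    using s_pos KB by (simp add: r_def)
  have "(\<lambda>l. 1 - (1 - e l) / r l * r l) \<longlonglongrightarrow> 1 - 1 * 0"
    by (intro tendsto_intros e_ratio decay)
  hence "(\<lambda>l. 1 - (1 - e l)) \<longlonglongrightarrow> 1"
    using r_pos by (simp add: less_imp_neq[symmetric])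
  hence e_lim: "e \<longlonglongrightarrow> 1" by simp
  \<comment> \<open>\<open>B - 1\<close> is
    \<open>\<sigma>v\<^sup>2 * \<sigma>w\<^sup>2 / 2\<close>, so the constant in the claim is the
    growth rate of \<open>1 / sqrt r\<close>.\<close>
  have coeff: "1 / 4 * \<sigma>v\<^sup>2 * \<sigma>w\<^sup>2 * inverse B * U = \<kappa> * U / 2"
    by (simp add: \<kappa>_def inverse_eq_divide) (simp add: assms(9))
  have "(\<lambda>l. (1 - e l) / r l * (r l * (\<kappa> * U / 2 * real l)\<^sup>2)) \<longlonglongrightarrow> 1 * 1"
    by (intro tendsto_intros e_ratio decay)
  moreover have "(1 - e l) / r l * (r l * (\<kappa> * U / 2 * real l)\<^sup>2) =
      (1 - e l) / (\<kappa> * U / 2 * real l) powi (-2)" for l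
    using r_pos[of l] by (simp add: power_int_minus inverse_eq_divide)
  ultimately have e_asymp: "(\<lambda>l. 1 - e l) \<sim>[sequentially] (\<lambda>l. (\<kappa> * U / 2 * real l) powi (-2))"
    by (intro asymp_equivI') simp
  define c where "c = \<kappa> * U / 2"
  have c: "c > 0" using \<kappa> U by (simp add: c_def)
  have "(\<lambda>l. K / c\<^sup>2 * (r l * (c * real l)\<^sup>2)) \<longlonglongrightarrow> K / c\<^sup>2 * 1"
    unfolding c_def by (intro tendsto_intros decay)
  \<comment> \<open>\<open>exp (real l * ln B)\<close> is \<open>B ^ l\<close>; at
    \<open>l = 0\<close> both sides are 0, since \<open>0 powi (-2)\<close> is 0.\<close>
  moreover have "K / c\<^sup>2 * (r l * (c * real l)\<^sup>2) = s l / (real l powi (-2) * exp (real l * ln B))" for l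
    using B K c by (simp add: r_def exp_of_nat_mult power_int_minus power_mult_distrib field_simps)
  ultimately have s_lim: "(\<lambda>l. s l / (real l powi (-2) * exp (real l * ln B))) \<longlonglongrightarrow> K / c\<^sup>2"
    by simp
  have "\<exists>t \<in> \<Theta>(\<lambda>l. real l). s \<in> \<Theta>(\<lambda>l. real l powi (-2) * exp (t l))"
  proof
    show "(\<lambda>l. real l * ln B) \<in> \<Theta>(\<lambda>l. real l)"
      using B by simp
    show "s \<in> \<Theta>(\<lambda>l. real l powi (-2) * exp (real l * ln B))"
      by (rule bigthetaI_tendsto[OF _ s_lim]) (use K c in auto)
  qed
  \<comment> \<open>An exact identity forces \<open>t l = ln (s l)\<close>. The quotient
    \<open>?f\<close> has a positive limit, so its logarithm divided by \<open>l\<close> vanishes,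
    as does \<open>2 * ln (real l) / real l\<close>; what remains of
    \<open>ln (s l) / real l\<close> is \<open>ln B > 0\<close>.\<close>
  moreover have "\<exists>t \<in> \<Theta>(\<lambda>l. real l). \<forall>l. s l = exp (t l)"
  proof
    let ?f = "\<lambda>l. s l / (real l powi (-2) * exp (real l * ln B))"
    have "(\<lambda>l. ln (?f l)) \<longlonglongrightarrow> ln (K / c\<^sup>2)"
      using K c by (intro tendsto_intros s_lim) auto
    hence "(\<lambda>l. ln (?f l) * (1 / real l) + (ln B - 2 * ln (real l) / real l)) \<longlonglongrightarrow>
        ln (K / c\<^sup>2) * 0 + (ln B - 0)"
      by (intro tendsto_add tendsto_mult tendsto_diff tendsto_const) (assumption | real_asymp)+
    moreover have "eventually (\<lambda>l. ln (?f l) * (1 / real l) + (ln B - 2 * ln (real l) / real l) =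
        ln (s l) / real l) sequentially"
      using eventually_gt_at_top[of 0]
    proof eventually_elim
      case (elim l)
      have "?f l = s l * (real l)\<^sup>2 / exp (real l * ln B)"
        by (simp add: power_int_minus field_simps)
      also have "ln \<dots> = ln (s l) + 2 * ln (real l) - real l * ln B"
        using elim s_pos[of l] by (simp add: ln_div ln_mult ln_realpow)
      finally have "ln (?f l) = ln (s l) + 2 * ln (real l) - real l * ln B" .
      thus ?case using elim by (simp only:) (simp add: field_simps)
    qed
    ultimately have "(\<lambda>l. ln (s l) / real l) \<longlonglongrightarrow> ln B"
      using Lim_transform_eventually by fastforce
    thus "(\<lambda>l. ln (s l)) \<in> \<Theta>(\<lambda>l. real l)"
      by (rule bigthetaI_tendsto[rotated]) (use B in auto)
    show "\<forall>l. s l = exp (ln (s l))"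
      using s_pos by simp
  qed
  ultimately show ?thesis
    unfolding coeff using e_lim e_asymp sep by blast
qed

end
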